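(* Let $(\mathcal{X},\mathcal{A},\mathcal{P})$ be a statistical model with $\mathcal{P}=\{P_\theta,\ \theta\in\Theta\}$, and let $\{\widehat{\mathcal{A}}_\gamma,\ \gamma\in\Gamma\}$ be the collection of all MVE-algebras for this model. Then $\widehat{\mathcal{A}}=\sigma(\widehat{\mathcal{A}}_\gamma,\ \gamma\in\Gamma)$, the smallest $\sigma$-algebra containing all the $\widehat{\mathcal{A}}_\gamma$, is the maximal MVE-algebra; that is, $\widehat{\mathcal{A}}$ is itself an MVE-algebra and it contains every MVE-algebra for this model.
   Context: A statistical model $(\mathcal{X},\mathcal{A},\mathcal{P})$ consists of a measurable space $(\mathcal{X},\mathcal{A})$ and a family $\mathcal{P}=\{P_\theta,\ \theta\in\Theta\}$ of probability measures on it, indexed by an arbitrary parameter set $\Theta$; $X$ denotes a random element of $(\mathcal{X},\mathcal{A})$ with distribution $P_\theta$, and $E_\theta$, $\mathrm{Var}_\theta$ denote expectation and variance under $P_\theta$. A statistic is a real-valued $\mathcal{A}$-measurable function of $X$; it has finite second moment if $E_\theta|\widehat g(X)|^2<\infty$ for all $\theta\in\Theta$. A statistic $\widehat g(X)$ with finite second moment is called a UMVUE (uniformly minimum variance unbiased estimator, of $g(\theta)=E_\theta\widehat g(X)$) if $\mathrm{Var}_\theta(\widehat g(X))\le \mathrm{Var}_\theta(\widetilde g(X))$ for all $\theta\in\Theta$, for every statistic $\widetilde g(X)$ with finite second moment satisfying $E_\theta\widetilde g(X)=E_\theta\widehat g(X)$ for all $\theta\in\Theta$. A subalgebra means a sub-$\sigma$-algebra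 of $\mathcal{A}$. A subalgebra $\widehat{\mathcal{A}}\subset\mathcal{A}$ is an MVE-algebra if every $\widehat{\mathcal{A}}$-measurable statistic with finite second moment is a UMVUE. *)

theory Defs
  imports "HOL-Probability.Probability"
begin

text \<open>
  The measurable space of observations is represented by a measure \<open>M\<close> of which only
  \<open>space M\<close> and \<open>sets M\<close> matter; the distributions are the \<open>P \<theta>\<close> for \<open>\<theta> \<in> \<Theta>\<close>.
\<close>

locale statistical_model =
  fixes M :: "'a measure" and \<Theta> :: "'p set" and P :: "'p \<Rightarrow> 'a measure"
  assumes prob_space_P: "\<And>\<theta>. \<theta> \<in> \<Theta> \<Longrightarrow> prob_space (P \<theta>)"
    and sets_P: "\<And>\<theta>. \<theta> \<in> \<Theta> \<Longrightarrow> sets (P \<theta>) = sets M"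

definition finite_second_moment ::
  "'p set \<Rightarrow> ('p \<Rightarrow> 'a measure) \<Rightarrow> ('a \<Rightarrow> real) \<Rightarrow> bool" where
  "finite_second_moment \<Theta> P g \<longleftrightarrow> (\<forall>\<theta>\<in>\<Theta>. integrable (P \<theta>) (\<lambda>x. \<bar>g x\<bar>\<^sup>2))"

definition umvue ::
  "'a measure \<Rightarrow> 'p set \<Rightarrow> ('p \<Rightarrow> 'a measure) \<Rightarrow> ('a \<Rightarrow> real) \<Rightarrow> bool" where
  "umvue M \<Theta> P g \<longleftrightarrow>
     g \<in> borel_measurable M \<and> finite_second_moment \<Theta> P g \<and>
     (\<forall>h \<in> borel_measurable M.
        finite_second_moment \<Theta> P h \<longrightarrow>
        (\<forall>\<theta>\<in>\<Theta>. prob_space.expectation (P \<theta>) h = prob_space.expectation (P \<theta>) g) \<longrightarrow>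
        (\<forall>\<theta>\<in>\<Theta>. prob_space.variance (P \<theta>) g \<le> prob_space.variance (P \<theta>) h))"

text \<open>
  A subalgebra is likewise represented by a measure \<open>F\<close>, whose values on sets are irrelevant:
  \<open>subalgebra\<close> and measurability depend on \<open>space F\<close> and \<open>sets F\<close> only.
\<close>

definition mve_algebra ::
  "'a measure \<Rightarrow> 'p set \<Rightarrow> ('p \<Rightarrow> 'a measure) \<Rightarrow> 'a measure \<Rightarrow> bool" where
  "mve_algebra M \<Theta> P F \<longleftrightarrow>
     subalgebra M F \<and>
     (\<forall>g \<in> borel_measurable F. finite_second_moment \<Theta> P g \<longrightarrow> umvue M \<Theta> P g)"

definition generated_mve_algebra ::
  "'a measure \<Rightarrow> 'p set \<Rightarrow> ('p \<Rightarrow> 'a measure) \<Rightarrow> 'a measure" where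
  "generated_mve_algebra M \<Theta> P = sigma (space M) (\<Union>F\<in>{F. mve_algebra M \<Theta> P F}. sets F)"

end

theory Submission
  imports Defs
begin

text \<open>
  Throughout, unbiased estimators of zero have finite second moment. By Lehmann and Scheffe, a
  statistic \<open>g\<close> with finite second moment is a UMVUE iff it is uncorrelated with every unbiased
  estimator \<open>u\<close> of zero, that is \<open>E\<^sub>\<theta> (g u) = 0\<close> for all \<open>\<theta>\<close>
  (\<open>umvue_iff_orthogonal_unbiased_zero\<close>). If \<open>g\<close> is a bounded UMVUE, then \<open>g u\<close> is again an unbiased
  estimator of zero, so the product of two bounded UMVUEs is a UMVUE.

  Call an event a UMVUE event if its indicator is a UMVUE. By the criterion, these are the events
  over which every unbiased estimator of zero integrates to \<open>0\<close>. Such events form a Dynkin system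
  by linearity and countable additivity of the integral, and an intersection-stable one by the
  remark on products; hence they form a \<open>\<sigma>\<close>-algebra (\<open>sigma_algebra_umvue_events\<close>).

  This single \<open>\<sigma>\<close>-algebra decides which subalgebras are MVE: a subalgebra is an MVE-algebra iff it
  consists of UMVUE events (\<open>mve_algebra_iff_umvue_events\<close>). For the nontrivial direction, if all
  events of \<open>F\<close> are UMVUE events, then \<open>E\<^sub>\<theta> (u | F) = 0\<close> for every unbiased estimator \<open>u\<close> of zero,
  so \<open>E\<^sub>\<theta> (g u) = E\<^sub>\<theta> (g E\<^sub>\<theta> (u | F)) = 0\<close> for every \<open>F\<close>-measurable \<open>g\<close> with finite second moment.
  The \<open>\<sigma>\<close>-algebra generated by all MVE-algebras therefore still consists of UMVUE events.
\<close>

section \<open>The Lehmann--Scheffe criterion\<close>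

definition unbiased_zero ::
  "'a measure \<Rightarrow> 'p set \<Rightarrow> ('p \<Rightarrow> 'a measure) \<Rightarrow> ('a \<Rightarrow> real) \<Rightarrow> bool" where
  "unbiased_zero M \<Theta> P u \<longleftrightarrow>
     u \<in> borel_measurable M \<and> finite_second_moment \<Theta> P u \<and>
     (\<forall>\<theta>\<in>\<Theta>. prob_space.expectation (P \<theta>) u = 0)"

context statistical_model
begin

lemma borel_measurable_P:
  assumes "\<theta> \<in> \<Theta>" "g \<in> borel_measurable M"
  shows "g \<in> borel_measurable (P \<theta>)"
  using assms measurable_cong_sets[OF sets_P refl] by blast

lemma finite_second_moment_integrable:
  assumes "\<theta> \<in> \<Theta>" "g \<in> borel_measurable M" "finite_second_moment \<Theta> P g"
  shows "integrable (P \<theta>) (\<lambda>x. (g x)\<^sup>2)" "integrable (P \<theta>) g"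
proof -
  interpret prob_space "P \<theta>" using assms prob_space_P by blast
  show "integrable (P \<theta>) (\<lambda>x. (g x)\<^sup>2)"
    using assms by (simp add: finite_second_moment_def)
  then show "integrable (P \<theta>) g"
    using borel_measurable_P[OF assms(1,2)] by (rule square_integrable_imp_integrable[rotated])
qed

lemma finite_second_moment_integrable_mult:
  assumes "\<theta> \<in> \<Theta>"
    and g: "g \<in> borel_measurable M" "finite_second_moment \<Theta> P g"
    and h: "h \<in> borel_measurable M" "finite_second_moment \<Theta> P h"
  shows "integrable (P \<theta>) (\<lambda>x. g x * h x)"
proof (rule Bochner_Integration.integrable_bound)
  show "integrable (P \<theta>) (\<lambda>x. (g x)\<^sup>2 + (h x)\<^sup>2)"
    using assms finite_second_moment_integrable(1) by (intro Bochner_Integration.integrable_add) auto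
  show "(\<lambda>x. g x * h x) \<in> borel_measurable (P \<theta>)"
    using assms borel_measurable_P by (intro borel_measurable_times) auto
  have "\<bar>a * b\<bar> \<le> a\<^sup>2 + b\<^sup>2" for a b :: real
  proof -
    have "2 * (\<bar>a\<bar> * \<bar>b\<bar>) \<le> a\<^sup>2 + b\<^sup>2"
      using sum_squares_bound[of "\<bar>a\<bar>" "\<bar>b\<bar>"] by simp
    moreover have "0 \<le> \<bar>a\<bar> * \<bar>b\<bar>"
      by simp
    ultimately show ?thesis
      unfolding abs_mult by linarith
  qed
  then show "AE x in P \<theta>. norm (g x * h x) \<le> norm ((g x)\<^sup>2 + (h x)\<^sup>2)"
    by simp
qed

lemma finite_second_moment_add_cmult:
  assumes g: "g \<in> borel_measurable M" "finite_second_moment \<Theta> P g"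
    and h: "h \<in> borel_measurable M" "finite_second_moment \<Theta> P h"
  shows "finite_second_moment \<Theta> P (\<lambda>x. g x + t * h x)"
  unfolding finite_second_moment_def
proof
  fix \<theta> assume \<theta>: "\<theta> \<in> \<Theta>"
  have "integrable (P \<theta>) (\<lambda>x. (g x)\<^sup>2 + 2 * t * (g x * h x) + t\<^sup>2 * (h x)\<^sup>2)"
    using finite_second_moment_integrable(1)[OF \<theta> g] finite_second_moment_integrable(1)[OF \<theta> h]
      finite_second_moment_integrable_mult[OF \<theta> g h] by simp
  then show "integrable (P \<theta>) (\<lambda>x. \<bar>g x + t * h x\<bar>\<^sup>2)"
    by (simp add: power2_sum power_mult_distrib algebra_simps)
qed

lemma variance_add_cmult_unbiased_zero:
  assumes \<theta>: "\<theta> \<in> \<Theta>"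
    and g: "g \<in> borel_measurable M" "finite_second_moment \<Theta> P g"
    and u: "unbiased_zero M \<Theta> P u"
  shows "prob_space.expectation (P \<theta>) (\<lambda>x. g x + t * u x) = prob_space.expectation (P \<theta>) g"
    and "prob_space.variance (P \<theta>) (\<lambda>x. g x + t * u x) =
      prob_space.variance (P \<theta>) g + 2 * t * prob_space.expectation (P \<theta>) (\<lambda>x. g x * u x)
        + t\<^sup>2 * prob_space.expectation (P \<theta>) (\<lambda>x. (u x)\<^sup>2)"
proof -
  interpret prob_space "P \<theta>" using \<theta> prob_space_P by blast
  have u': "u \<in> borel_measurable M" "finite_second_moment \<Theta> P u" "expectation u = 0"
    using u \<theta> by (auto simp: unbiased_zero_def)
  have ints: "integrable (P \<theta>) g" "integrable (P \<theta>) u" "integrable (P \<theta>) (\<lambda>x. (g x)\<^sup>2)"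
      "integrable (P \<theta>) (\<lambda>x. (u x)\<^sup>2)" "integrable (P \<theta>) (\<lambda>x. g x * u x)"
    using finite_second_moment_integrable[OF \<theta> g] finite_second_moment_integrable[OF \<theta> u'(1,2)]
      finite_second_moment_integrable_mult[OF \<theta> g u'(1,2)] by simp_all
  show E: "expectation (\<lambda>x. g x + t * u x) = expectation g"
    using ints u' \<theta> by simp
  have sq: "(g x + t * u x)\<^sup>2 = (g x)\<^sup>2 + 2 * t * (g x * u x) + t\<^sup>2 * (u x)\<^sup>2" for x
    by (simp add: power2_sum power_mult_distrib algebra_simps)
  have "integrable (P \<theta>) (\<lambda>x. (g x + t * u x)\<^sup>2)"
    unfolding sq using ints by simp
  then have "variance (\<lambda>x. g x + t * u x) = expectation (\<lambda>x. (g x + t * u x)\<^sup>2) - (expectation g)\<^sup>2"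
    using ints u' by (subst variance_eq) simp_all
  also have "expectation (\<lambda>x. (g x + t * u x)\<^sup>2) = expectation (\<lambda>x. (g x)\<^sup>2)
      + 2 * t * expectation (\<lambda>x. g x * u x) + t\<^sup>2 * expectation (\<lambda>x. (u x)\<^sup>2)"
    unfolding sq using ints by simp
  finally show "variance (\<lambda>x. g x + t * u x) =
      variance g + 2 * t * expectation (\<lambda>x. g x * u x) + t\<^sup>2 * expectation (\<lambda>x. (u x)\<^sup>2)"
    using ints by (simp add: variance_eq)
qed

text \<open>
  The unbiased estimators of \<open>E\<^sub>\<theta> g\<close> with finite second moment are the \<open>g + u\<close> with \<open>u\<close> an
  unbiased estimator of zero, and \<open>t \<mapsto> Var\<^sub>\<theta> (g + t u)\<close> is a polynomial of degree at
  most two whose linear coefficient is \<open>2 E\<^sub>\<theta> (g u)\<close>. It has its minimum at \<open>t = 0\<close> exactly when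
  that coefficient vanishes.
\<close>

lemma umvue_iff_orthogonal_unbiased_zero:
  assumes g: "g \<in> borel_measurable M" "finite_second_moment \<Theta> P g"
  shows "umvue M \<Theta> P g \<longleftrightarrow>
    (\<forall>u. unbiased_zero M \<Theta> P u \<longrightarrow>
      (\<forall>\<theta>\<in>\<Theta>. prob_space.expectation (P \<theta>) (\<lambda>x. g x * u x) = 0))"
proof (intro iffI allI impI ballI)
  fix u \<theta> assume umv: "umvue M \<Theta> P g" and u: "unbiased_zero M \<Theta> P u" and \<theta>: "\<theta> \<in> \<Theta>"
  note u' = u[unfolded unbiased_zero_def]
  define b where "b = prob_space.expectation (P \<theta>) (\<lambda>x. g x * u x)"
  define c where "c = prob_space.expectation (P \<theta>) (\<lambda>x. (u x)\<^sup>2)"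
  have nonneg: "0 \<le> 2 * t * b + t\<^sup>2 * c" for t
  proof -
    have "(\<lambda>x. g x + t * u x) \<in> borel_measurable M"
      using g u' by (intro borel_measurable_add borel_measurable_times) auto
    moreover have "finite_second_moment \<Theta> P (\<lambda>x. g x + t * u x)"
      using g u' by (intro finite_second_moment_add_cmult) auto
    ultimately have "prob_space.variance (P \<theta>) g \<le> prob_space.variance (P \<theta>) (\<lambda>x. g x + t * u x)"
      using umv \<theta> variance_add_cmult_unbiased_zero(1)[OF _ g u] unfolding umvue_def by blast
    then show ?thesis
      unfolding variance_add_cmult_unbiased_zero(2)[OF \<theta> g u] b_def c_def by simp
  qed
  \<comment> \<open>The step width \<open>1 / (c + 1)\<close> in place of the optimal \<open>1 / c\<close> covers the case \<open>c = 0\<close>.\<close>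
  define s where "s = 1 / (c + 1)"
  have "c \<ge> 0"
    unfolding c_def by simp
  then have s: "s > 0" "s * c \<le> 1"
    by (auto simp: s_def)
  have "0 \<le> 2 * (- (b * s)) * b + (- (b * s))\<^sup>2 * c"
    by (rule nonneg)
  also have "\<dots> = (b\<^sup>2 * s) * (s * c) - 2 * (b\<^sup>2 * s)"
    by (simp add: power2_eq_square)
  also have "\<dots> \<le> (b\<^sup>2 * s) * 1 - 2 * (b\<^sup>2 * s)"
    using s by (intro diff_right_mono mult_left_mono) auto
  finally have "b\<^sup>2 * s \<le> 0"
    by linarith
  then have "b = 0"
    using s by (simp add: mult_le_0_iff)
  then show "prob_space.expectation (P \<theta>) (\<lambda>x. g x * u x) = 0"
    unfolding b_def .
next
  assume orth: "\<forall>u. unbiased_zero M \<Theta> P u \<longrightarrow>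
      (\<forall>\<theta>\<in>\<Theta>. prob_space.expectation (P \<theta>) (\<lambda>x. g x * u x) = 0)"
  show "umvue M \<Theta> P g"
    unfolding umvue_def
  proof (intro conjI g ballI impI)
    fix h \<theta> assume h: "h \<in> borel_measurable M" "finite_second_moment \<Theta> P h"
      and E: "\<forall>\<theta>\<in>\<Theta>. prob_space.expectation (P \<theta>) h = prob_space.expectation (P \<theta>) g"
      and \<theta>: "\<theta> \<in> \<Theta>"
    define u where "u = (\<lambda>x. h x - g x)"
    have "finite_second_moment \<Theta> P u"
      using finite_second_moment_add_cmult[OF h g, of "-1"] by (simp add: u_def)
    then have u: "unbiased_zero M \<Theta> P u"
      using g h E finite_second_moment_integrable(2) by (simp add: unbiased_zero_def u_def)
    have "h = (\<lambda>x. g x + 1 * u x)"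
      by (simp add: u_def)
    then have "prob_space.variance (P \<theta>) h =
        prob_space.variance (P \<theta>) g + prob_space.expectation (P \<theta>) (\<lambda>x. (u x)\<^sup>2)"
      using variance_add_cmult_unbiased_zero(2)[OF \<theta> g u, of 1] orth u \<theta> by simp
    then show "prob_space.variance (P \<theta>) g \<le> prob_space.variance (P \<theta>) h"
      by simp
  qed
qed

end

section \<open>The \<open>\<sigma>\<close>-algebra of UMVUE events\<close>

definition umvue_events :: "'a measure \<Rightarrow> 'p set \<Rightarrow> ('p \<Rightarrow> 'a measure) \<Rightarrow> 'a set set" where
  "umvue_events M \<Theta> P = {A \<in> sets M. umvue M \<Theta> P (indicator A)}"

context statistical_model
begin

lemma finite_second_moment_indicator_mult:
  assumes "A \<in> sets M" and g: "g \<in> borel_measurable M" "finite_second_moment \<Theta> P g"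
  shows "finite_second_moment \<Theta> P (\<lambda>x. indicator A x * g x)"
  unfolding finite_second_moment_def
proof
  fix \<theta> assume \<theta>: "\<theta> \<in> \<Theta>"
  have "integrable (P \<theta>) (\<lambda>x. indicator A x *\<^sub>R (g x)\<^sup>2)"
    using assms sets_P[OF \<theta>] finite_second_moment_integrable(1)[OF \<theta> g]
    by (intro integrable_mult_indicator) auto
  moreover have "indicator A x *\<^sub>R (g x)\<^sup>2 = \<bar>indicator A x * g x\<bar>\<^sup>2" for x
    by (simp add: indicator_def)
  ultimately show "integrable (P \<theta>) (\<lambda>x. \<bar>indicator A x * g x\<bar>\<^sup>2)"
    by simp
qed

lemma finite_second_moment_indicator:
  assumes "A \<in> sets M"
  shows "finite_second_moment \<Theta> P (indicator A)"
proof -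
  have "finite_second_moment \<Theta> P (\<lambda>x. 1)"
    using prob_space_P
    by (auto simp: finite_second_moment_def intro!: finite_measure.integrable_const prob_space.finite_measure)
  from finite_second_moment_indicator_mult[OF assms _ this] show ?thesis
    by simp
qed

lemma umvue_events_iff:
  "A \<in> umvue_events M \<Theta> P \<longleftrightarrow>
    A \<in> sets M \<and> (\<forall>u. unbiased_zero M \<Theta> P u \<longrightarrow> (\<forall>\<theta>\<in>\<Theta>. (LINT x:A|P \<theta>. u x) = 0))"
proof (cases "A \<in> sets M")
  case True
  then show ?thesis
    using umvue_iff_orthogonal_unbiased_zero[OF _ finite_second_moment_indicator[OF True]]
    by (simp add: umvue_events_def set_lebesgue_integral_def)
qed (simp add: umvue_events_def)

lemma unbiased_zero_indicator_mult:
  assumes A: "A \<in> umvue_events M \<Theta> P" and u: "unbiased_zero M \<Theta> P u"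
  shows "unbiased_zero M \<Theta> P (\<lambda>x. indicator A x * u x)"
proof -
  have sets: "A \<in> sets M" and zero: "\<forall>\<theta>\<in>\<Theta>. (LINT x:A|P \<theta>. u x) = 0"
    using A u by (simp_all add: umvue_events_iff)
  have u': "u \<in> borel_measurable M" "finite_second_moment \<Theta> P u"
    using u by (simp_all add: unbiased_zero_def)
  have "(\<lambda>x. indicator A x * u x) \<in> borel_measurable M"
    using sets u'(1) by (intro borel_measurable_times) auto
  then show ?thesis
    using finite_second_moment_indicator_mult[OF sets u'] zero
    by (simp add: unbiased_zero_def set_lebesgue_integral_def)
qed

text \<open>
  Complements and disjoint unions stay UMVUE events because \<open>A \<mapsto> E\<^sub>\<theta> (1\<^sub>A u)\<close> is a signed measure of
  total mass zero. For an intersection \<open>A \<inter> B\<close>, split \<open>1\<^bsub>A \<inter> B\<^esub> u = 1\<^sub>A (1\<^sub>B u)\<close> and use that \<open>1\<^sub>B u\<close>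
  is itself an unbiased estimator of zero.
\<close>

lemma sigma_algebra_umvue_events: "sigma_algebra (space M) (umvue_events M \<Theta> P)"
proof -
  have int: "integrable (P \<theta>) u" if "unbiased_zero M \<Theta> P u" "\<theta> \<in> \<Theta>" for u \<theta>
    using that unfolding unbiased_zero_def by (blast intro: finite_second_moment_integrable(2))
  have set_int: "set_integrable (P \<theta>) A u" if "unbiased_zero M \<Theta> P u" "\<theta> \<in> \<Theta>" "A \<in> sets M" for u \<theta> A
    unfolding set_integrable_def using int[OF that(1,2)] that(3) sets_P[OF that(2)]
    by (intro integrable_mult_indicator) simp_all
  have sets: "A \<in> sets M" if "A \<in> umvue_events M \<Theta> P" for A
    using that by (simp add: umvue_events_def)
  have space: "space (P \<theta>) = space M" if "\<theta> \<in> \<Theta>" for \<theta>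
    using sets_P[OF that] by (rule sets_eq_imp_space_eq)
  have "Dynkin_system (space M) (umvue_events M \<Theta> P)"
  proof (rule Dynkin_systemI')
    fix A assume "A \<in> umvue_events M \<Theta> P"
    then show "A \<subseteq> space M"
      by (intro sets.sets_into_space sets)
  next
    show "{} \<in> umvue_events M \<Theta> P"
      by (simp add: umvue_events_iff set_lebesgue_integral_def)
  next
    fix A assume A: "A \<in> umvue_events M \<Theta> P"
    have "(LINT x:space M - A|P \<theta>. u x) = 0" if u: "unbiased_zero M \<Theta> P u" and \<theta>: "\<theta> \<in> \<Theta>" for u \<theta>
    proof -
      have "(LINT x:(space M - A) \<union> A|P \<theta>. u x) =
          (LINT x:space M - A|P \<theta>. u x) + (LINT x:A|P \<theta>. u x)"
        using sets[OF A] by (intro set_integral_Un set_int[OF u \<theta>]) auto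
      moreover have "(space M - A) \<union> A = space (P \<theta>)"
        using sets.sets_into_space[OF sets[OF A]] space[OF \<theta>] by blast
      moreover have "(LINT x:space (P \<theta>)|P \<theta>. u x) = 0"
        using set_integral_space[OF int[OF u \<theta>]] u \<theta> by (simp add: unbiased_zero_def)
      ultimately show ?thesis
        using A u \<theta> by (simp add: umvue_events_iff)
    qed
    then show "space M - A \<in> umvue_events M \<Theta> P"
      using sets[OF A] by (simp add: umvue_events_iff)
  next
    fix A :: "nat \<Rightarrow> 'a set"
    assume disj: "disjoint_family A" and A: "range A \<subseteq> umvue_events M \<Theta> P"
    have A_sets: "A i \<in> sets M" for i
      using A sets by blast
    have "(LINT x:(\<Union>i. A i)|P \<theta>. u x) = 0" if u: "unbiased_zero M \<Theta> P u" and \<theta>: "\<theta> \<in> \<Theta>" for u \<theta>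
    proof -
      have "(LINT x:(\<Union>i. A i)|P \<theta>. u x) = (\<Sum>i. LINT x:A i|P \<theta>. u x)"
        using A_sets sets_P[OF \<theta>] disj
        by (intro lebesgue_integral_countable_add set_int[OF u \<theta>])
           (auto simp: disjoint_family_on_def)
      also have "\<dots> = 0"
        using A u \<theta> by (simp add: umvue_events_iff image_subset_iff)
      finally show ?thesis .
    qed
    then show "(\<Union>i. A i) \<in> umvue_events M \<Theta> P"
      using A_sets by (simp add: umvue_events_iff)
  qed
  moreover have "Int_stable (umvue_events M \<Theta> P)"
  proof (rule Int_stableI)
    fix A B assume A: "A \<in> umvue_events M \<Theta> P" and B: "B \<in> umvue_events M \<Theta> P"
    have "(LINT x:A \<inter> B|P \<theta>. u x) = 0" if u: "unbiased_zero M \<Theta> P u" and \<theta>: "\<theta> \<in> \<Theta>" for u \<theta>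
    proof -
      have "(LINT x:A|P \<theta>. indicator B x * u x) = 0"
        using A \<theta> unbiased_zero_indicator_mult[OF B u] by (simp add: umvue_events_iff)
      then show ?thesis
        by (simp add: set_lebesgue_integral_def indicator_inter_arith mult.assoc)
    qed
    then show "A \<inter> B \<in> umvue_events M \<Theta> P"
      using sets[OF A] sets[OF B] by (simp add: umvue_events_iff)
  qed
  ultimately show ?thesis
    using Dynkin_system.sigma_algebra_eq_Int_stable by blast
qed

end

section \<open>MVE-algebras\<close>

context statistical_model
begin

text \<open>
  To pass from events to statistics, note that \<open>E\<^sub>\<theta> (u | F)\<close> is determined by the integrals of \<open>u\<close>
  over the events of \<open>F\<close>; if these all vanish, then so does \<open>E\<^sub>\<theta> (u | F)\<close>.
\<close>

lemma mve_algebra_iff_umvue_events: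
  "mve_algebra M \<Theta> P F \<longleftrightarrow> space F = space M \<and> sets F \<subseteq> umvue_events M \<Theta> P"
proof (intro iffI conjI subsetI)
  assume F: "mve_algebra M \<Theta> P F"
  then show "space F = space M"
    by (simp add: mve_algebra_def subalgebra_def)
  fix A assume A: "A \<in> sets F"
  then have "A \<in> sets M"
    using F by (auto simp: mve_algebra_def subalgebra_def)
  then show "A \<in> umvue_events M \<Theta> P"
    using F A finite_second_moment_indicator[of A] by (simp add: mve_algebra_def umvue_events_def)
next
  assume F: "space F = space M \<and> sets F \<subseteq> umvue_events M \<Theta> P"
  then have sub: "subalgebra M F"
    by (auto simp: subalgebra_def umvue_events_def)
  have "umvue M \<Theta> P g" if g: "g \<in> borel_measurable F" "finite_second_moment \<Theta> P g" for g
  proof -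
    have gM: "g \<in> borel_measurable M"
      using measurable_from_subalg[OF sub g(1)] .
    have "prob_space.expectation (P \<theta>) (\<lambda>x. g x * u x) = 0"
      if u: "unbiased_zero M \<Theta> P u" and \<theta>: "\<theta> \<in> \<Theta>" for u \<theta>
    proof -
      interpret prob_space "P \<theta>" using \<theta> prob_space_P by blast
      have "subalgebra (P \<theta>) F"
        using sub sets_P[OF \<theta>] sets_eq_imp_space_eq[OF sets_P[OF \<theta>]] by (simp add: subalgebra_def)
      then interpret finite_measure_subalgebra "P \<theta>" F
        by unfold_locales
      have u': "u \<in> borel_measurable M" "finite_second_moment \<Theta> P u"
        using u by (simp_all add: unbiased_zero_def)
      have int_u: "integrable (P \<theta>) u"
        using finite_second_moment_integrable(2)[OF \<theta> u'] .
      have "AE x in P \<theta>. real_cond_exp (P \<theta>) F u x = 0"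
      proof (rule real_cond_exp_charact)
        fix A assume "A \<in> sets F"
        then show "(LINT x:A|P \<theta>. u x) = (LINT x:A|P \<theta>. 0)"
          using F u \<theta> by (auto simp: umvue_events_iff)
      qed (use int_u in auto)
      then have "AE x in P \<theta>. g x * real_cond_exp (P \<theta>) F u x = 0"
        by eventually_elim simp
      then have "expectation (\<lambda>x. g x * real_cond_exp (P \<theta>) F u x) = 0"
        by (rule integral_eq_zero_AE)
      then show ?thesis
        using real_cond_exp_intg(2)[OF finite_second_moment_integrable_mult[OF \<theta> gM g(2) u']
            g(1) borel_measurable_P[OF \<theta> u'(1)]] by simp
    qed
    then show ?thesis
      using umvue_iff_orthogonal_unbiased_zero[OF gM g(2)] by blast
  qed
  with sub show "mve_algebra M \<Theta> P F"
    by (simp add: mve_algebra_def)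
qed

end

theorem corollary1:
  fixes M :: "'a measure" and \<Theta> :: "'p set" and P :: "'p \<Rightarrow> 'a measure"
  assumes "statistical_model M \<Theta> P"
  shows "mve_algebra M \<Theta> P (generated_mve_algebra M \<Theta> P) \<and>
    (\<forall>F. mve_algebra M \<Theta> P F \<longrightarrow> subalgebra (generated_mve_algebra M \<Theta> P) F)"
proof -
  interpret statistical_model M \<Theta> P by fact
  let ?G = "\<Union>F\<in>{F. mve_algebra M \<Theta> P F}. sets F"
  have G: "?G \<subseteq> umvue_events M \<Theta> P"
    using mve_algebra_iff_umvue_events by blast
  then have "?G \<subseteq> Pow (space M)"
    by (auto simp: umvue_events_def dest: sets.sets_into_space)
  then have gen: "sets (generated_mve_algebra M \<Theta> P) = sigma_sets (space M) ?G"
      "space (generated_mve_algebra M \<Theta> P) = space M"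
    by (simp_all add: generated_mve_algebra_def)
  have "sigma_sets (space M) ?G \<subseteq> umvue_events M \<Theta> P"
    using sigma_algebra.sigma_sets_subset[OF sigma_algebra_umvue_events G] .
  then have "mve_algebra M \<Theta> P (generated_mve_algebra M \<Theta> P)"
    by (simp add: mve_algebra_iff_umvue_events gen)
  moreover have "subalgebra (generated_mve_algebra M \<Theta> P) F" if "mve_algebra M \<Theta> P F" for F
    using that by (auto simp: subalgebra_def gen mve_algebra_iff_umvue_events)
  ultimately show ?thesis
    by blast
qed

end
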